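(* Let $\mu$ be a positive rational number. The topological space $(\Sigma_\mu,\mathcal{T})$ is a second countable, Hausdorff ($T_2$) space.
   Context: Matrices are over $\mathbb{R}$. Write $\mu=\mu_y/\mu_x$ with $\mu_y,\mu_x$ coprime positive integers, $\mathcal{M}_\mu^i:=\mathcal{M}_{i\mu_y\times i\mu_x}$, and $\mathcal{M}_\mu:=\bigcup_{i\ge1}\mathcal{M}_\mu^i$. $A\sim B$ means $A\otimes I_s=B\otimes I_t$ (Kronecker product) for some positive integers $s,t$; $\langle A\rangle$ is the class of $A$ and $\Sigma_\mu:=\mathcal{M}_\mu/\!\sim$. The space $\mathcal{M}_\mu^i$ is identified with Euclidean space $\mathbb{R}^{i^2\mu_y\mu_x}$ with its usual topology. For a nonempty open set $o_i\subset\mathcal{M}_\mu^i$ put $s_i(o_i):=\{\langle A\rangle\in\Sigma_\mu : \langle A\rangle\cap o_i\ne\emptyset\}$. Let $O_i$ be the set of open balls in $\mathcal{M}_\mu^i$ with rational center and rational radius and $S_i:=\{s_i(o_i): o_i\in O_i\}$. $\mathcal{T}$ is the topology on $\Sigma_\mu$ generated by the sub-basis $S=\bigcup_{i\ge1}S_i$. *)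

theory Defs
  imports "HOL-Analysis.Analysis" "Jordan_Normal_Form.Matrix"
begin

definition kronecker :: "real mat \<Rightarrow> real mat \<Rightarrow> real mat" where
  "kronecker A B = mat (dim_row A * dim_row B) (dim_col A * dim_col B)
     (\<lambda>(i, j). A $$ (i div dim_row B, j div dim_col B) * B $$ (i mod dim_row B, j mod dim_col B))"

text \<open>For positive \<open>\<mu>\<close>, \<open>mu_y \<mu>\<close> and \<open>mu_x \<mu>\<close> are the coprime positive integers with
  \<open>\<mu> = mu_y \<mu> / mu_x \<mu>\<close>.\<close>

definition mu_y :: "rat \<Rightarrow> nat" where
  "mu_y \<mu> = nat (fst (quotient_of \<mu>))"

definition mu_x :: "rat \<Rightarrow> nat" where
  "mu_x \<mu> = nat (snd (quotient_of \<mu>))"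

definition Mat_level :: "rat \<Rightarrow> nat \<Rightarrow> real mat set" where
  "Mat_level \<mu> i = carrier_mat (i * mu_y \<mu>) (i * mu_x \<mu>)"

definition Mat_ratio :: "rat \<Rightarrow> real mat set" where
  "Mat_ratio \<mu> = (\<Union>i\<in>{1..}. Mat_level \<mu> i)"

definition mat_equiv :: "real mat \<Rightarrow> real mat \<Rightarrow> bool" where
  "mat_equiv A B \<longleftrightarrow> (\<exists>s>0. \<exists>t>0. kronecker A (1\<^sub>m s) = kronecker B (1\<^sub>m t))"

definition mat_equiv_rel :: "rat \<Rightarrow> (real mat \<times> real mat) set" where
  "mat_equiv_rel \<mu> = {(A, B). A \<in> Mat_ratio \<mu> \<and> B \<in> Mat_ratio \<mu> \<and> mat_equiv A B}"

definition Sigma_quot :: "rat \<Rightarrow> real mat set set" where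
  "Sigma_quot \<mu> = Mat_ratio \<mu> // mat_equiv_rel \<mu>"

text \<open>The Euclidean distance of two matrices of the same size, all entries being read as the
  coordinates of a single vector.\<close>

definition mat_dist :: "real mat \<Rightarrow> real mat \<Rightarrow> real" where
  "mat_dist A B = L2_set (\<lambda>(p, q). A $$ (p, q) - B $$ (p, q)) ({..<dim_row A} \<times> {..<dim_col A})"

definition mat_ball :: "rat \<Rightarrow> nat \<Rightarrow> real mat \<Rightarrow> real \<Rightarrow> real mat set" where
  "mat_ball \<mu> i C r = {A \<in> Mat_level \<mu> i. mat_dist C A < r}"

definition rational_balls :: "rat \<Rightarrow> nat \<Rightarrow> real mat set set" where
  "rational_balls \<mu> i =
     {mat_ball \<mu> i C r | C r. C \<in> Mat_level \<mu> i \<and> elements_mat C \<subseteq> \<rat> \<and> r \<in> \<rat> \<and> 0 < r}"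

text \<open>The set of classes that meet \<open>U\<close>. For \<open>U \<subseteq> Mat_level \<mu> i\<close> this is \<open>s\<^sub>i(U)\<close>; no separate
  index is needed.\<close>

definition classes_meeting :: "rat \<Rightarrow> real mat set \<Rightarrow> real mat set set" where
  "classes_meeting \<mu> U = {K \<in> Sigma_quot \<mu>. K \<inter> U \<noteq> {}}"

definition sub_basis :: "rat \<Rightarrow> real mat set set set" where
  "sub_basis \<mu> = (\<Union>i\<in>{1..}. classes_meeting \<mu> ` rational_balls \<mu> i)"

definition Sigma_topology :: "rat \<Rightarrow> real mat set topology" where
  "Sigma_topology \<mu> = topology (arbitrary union_of
     (finite intersection_of (\<lambda>U. U \<in> sub_basis \<mu>) relative_to Sigma_quot \<mu>))"

lemma topspace_Sigma_topology: "topspace (Sigma_topology \<mu>) = Sigma_quot \<mu>"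
  by (simp add: Sigma_topology_def)

lemma mu_y_mu_x:
  assumes "\<mu> > 0"
  shows "mu_y \<mu> > 0" "mu_x \<mu> > 0" "coprime (mu_y \<mu>) (mu_x \<mu>)"
    "\<mu> = of_nat (mu_y \<mu>) / of_nat (mu_x \<mu>)"
proof -
  obtain p q where pq: "quotient_of \<mu> = (p, q)" by (cases "quotient_of \<mu>")
  have q: "q > 0" using quotient_of_denom_pos[OF pq] .
  have \<mu>: "\<mu> = of_int p / of_int q" using quotient_of_div[OF pq] .
  have p: "p > 0" using assms q by (simp add: \<mu> zero_less_divide_iff)
  have "coprime p q" using quotient_of_coprime[OF pq] .
  moreover have m: "int (mu_y \<mu>) = p" "int (mu_x \<mu>) = q"
    using p q by (simp_all add: mu_y_def mu_x_def pq)
  ultimately show "mu_y \<mu> > 0" "mu_x \<mu> > 0" "coprime (mu_y \<mu>) (mu_x \<mu>)"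
    using p q by (simp_all flip: coprime_int_iff)
  show "\<mu> = of_nat (mu_y \<mu>) / of_nat (mu_x \<mu>)"
    using \<mu> by (simp flip: m)
qed

lemma kronecker_one_one:
  assumes "s > 0" "u > 0"
  shows "kronecker (kronecker A (1\<^sub>m s)) (1\<^sub>m u) = kronecker A (1\<^sub>m (s * u))"
proof (rule eq_matI)
  fix i j
  assume "i < dim_row (kronecker A (1\<^sub>m (s * u)))" "j < dim_col (kronecker A (1\<^sub>m (s * u)))"
  then have ij: "i < dim_row A * s * u" "j < dim_col A * s * u"
    by (simp_all add: kronecker_def mult.assoc)
  then have d: "i div u < dim_row A * s" "j div u < dim_col A * s"
    using assms by (simp_all add: less_mult_imp_div_less)
  have "i mod (u * s) = j mod (u * s) \<longleftrightarrow> i div u mod s = j div u mod s \<and> i mod u = j mod u"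
    (is "?L \<longleftrightarrow> ?R")
  proof
    assume L: ?L
    have "i mod u = j mod u" using arg_cong[OF L, of "\<lambda>k. k mod u"] by (simp add: mod_mod_cancel)
    moreover have "i div u mod s = j div u mod s"
      using L calculation assms by (simp add: mod_mult2_eq)
    ultimately show ?R by simp
  qed (simp add: mod_mult2_eq)
  moreover have "i div (s * u) = i div u div s" "j div (s * u) = j div u div s"
    by (simp_all add: mult.commute[of s u] div_mult2_eq)
  ultimately show
    "kronecker (kronecker A (1\<^sub>m s)) (1\<^sub>m u) $$ (i, j) = kronecker A (1\<^sub>m (s * u)) $$ (i, j)"
    using ij d assms by (simp add: kronecker_def mult.commute[of u s] flip: mult.assoc)
qed (simp_all add: kronecker_def mult.assoc)

lemma mat_equivI:
  assumes "s > 0" "t > 0" "kronecker A (1\<^sub>m s) = kronecker B (1\<^sub>m t)"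
  shows "mat_equiv A B"
  using assms unfolding mat_equiv_def by (intro exI conjI)

lemma mat_equivE:
  assumes "mat_equiv A B"
  obtains s t where "s > 0" "t > 0" "kronecker A (1\<^sub>m s) = kronecker B (1\<^sub>m t)"
  using assms unfolding mat_equiv_def by (elim exE conjE)

lemma mat_equiv_refl: "mat_equiv A A"
  by (rule mat_equivI[of 1 1]) simp_all

lemma mat_equiv_sym: "mat_equiv A B \<Longrightarrow> mat_equiv B A"
  by (elim mat_equivE, rule mat_equivI) (assumption | erule sym)+

lemma mat_equiv_trans:
  assumes "mat_equiv A B" "mat_equiv B C"
  shows "mat_equiv A C"
proof -
  obtain s t where 1: "s > 0" "t > 0" "kronecker A (1\<^sub>m s) = kronecker B (1\<^sub>m t)"
    using assms(1) by (rule mat_equivE)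
  obtain u v where 2: "u > 0" "v > 0" "kronecker B (1\<^sub>m u) = kronecker C (1\<^sub>m v)"
    using assms(2) by (rule mat_equivE)
  have "kronecker A (1\<^sub>m (s * u)) = kronecker B (1\<^sub>m (u * t))"
    by (simp only: kronecker_one_one[OF 1(1) 2(1), symmetric] 1(3) kronecker_one_one[OF 1(2) 2(1)]
        mult.commute[of t u])
  also have "\<dots> = kronecker C (1\<^sub>m (v * t))"
    by (simp only: kronecker_one_one[OF 2(1) 1(2), symmetric] 2(3) kronecker_one_one[OF 2(2) 1(2)])
  finally show ?thesis
    by (rule mat_equivI[rotated 2]) (use 1 2 in simp_all)
qed

lemma equiv_mat_equiv_rel: "equiv (Mat_ratio \<mu>) (mat_equiv_rel \<mu>)"
proof (rule equivI)
  show "mat_equiv_rel \<mu> \<subseteq> Mat_ratio \<mu> \<times> Mat_ratio \<mu>"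
    by (auto simp: mat_equiv_rel_def)
  show "refl_on (Mat_ratio \<mu>) (mat_equiv_rel \<mu>)"
    by (simp add: refl_on_def mat_equiv_rel_def mat_equiv_refl)
  show "sym (mat_equiv_rel \<mu>)"
    by (auto simp: sym_def mat_equiv_rel_def intro: mat_equiv_sym)
  show "trans (mat_equiv_rel \<mu>)"
    by (auto simp: trans_def mat_equiv_rel_def intro: mat_equiv_trans)
qed

end

theory Submission
  imports Defs
begin

text \<open>The equivalence \<open>\<sim>\<close> is trivial on matrices of equal size, and any two classes have
  representatives of a common size. Distinct classes therefore have distinct representatives in one
  Euclidean space; disjoint rational balls around these yield disjoint sub-basic sets, because
  a class meeting both balls would have two different members of the same size. Countability of the
  sub-basis gives second countability.\<close>

text \<open>The finite intersections of sub-basic sets, cut down to \<open>U\<close>, form a base,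
  and a countable family has only countably many finite subfamilies.\<close>

lemma second_countable_subbase:
  assumes "countable \<B>"
  shows "second_countable
    (topology (arbitrary union_of (finite intersection_of (\<lambda>V. V \<in> \<B>) relative_to U)))"
proof -
  have "{V. (finite intersection_of (\<lambda>V. V \<in> \<B>) relative_to U) V}
      \<subseteq> (\<lambda>\<F>. U \<inter> \<Inter>\<F>) ` {\<F>. finite \<F> \<and> \<F> \<subseteq> \<B>}"
    by (auto simp: relative_to_def intersection_of_def)
  then have "countable {V. (finite intersection_of (\<lambda>V. V \<in> \<B>) relative_to U) V}"
    by (rule countable_subset)
      (intro countable_image countable_Collect_finite_subset assms)
  moreover have "openin (topology (arbitrary union_of
        (finite intersection_of (\<lambda>V. V \<in> \<B>) relative_to U)))
      = arbitrary union_of (finite intersection_of (\<lambda>V. V \<in> \<B>) relative_to U)"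
    by (rule ext) (rule openin_subbase)
  ultimately show ?thesis
    unfolding second_countable
    by (intro exI[of _ "{V. (finite intersection_of (\<lambda>V. V \<in> \<B>) relative_to U) V}"]) simp
qed

text \<open>A matrix of fixed size is a function on a finite index set, and there are only countably
  many such functions into a countable set.\<close>

lemma countable_carrier_mat:
  assumes "countable S"
  shows "countable {A \<in> carrier_mat m n. elements_mat A \<subseteq> S}"
proof (rule countable_subset)
  show "{A \<in> carrier_mat m n. elements_mat A \<subseteq> S}
      \<subseteq> mat m n ` (\<Pi>\<^sub>E _\<in>{..<m} \<times> {..<n}. S)"
  proof clarify
    fix A
    assume A: "A \<in> carrier_mat m n" "elements_mat A \<subseteq> S"
    \<comment> \<open>Restricting makes the entry function extensional, as membership in
      \<open>PiE\<close> demands; \<open>mat\<close> reads it only on the index range.\<close>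
    let ?f = "restrict (($$) A) ({..<m} \<times> {..<n})"
    have "A = mat m n ?f"
      by (rule eq_matI) (use A in auto)
    moreover have "?f \<in> (\<Pi>\<^sub>E _\<in>{..<m} \<times> {..<n}. S)"
      using A(2) elements_matI[OF A(1)] by (auto intro!: restrict_PiE_iff[THEN iffD2])
    ultimately show "A \<in> mat m n ` (\<Pi>\<^sub>E _\<in>{..<m} \<times> {..<n}. S)"
      by (rule image_eqI)
  qed
  show "countable (mat m n ` (\<Pi>\<^sub>E _\<in>{..<m} \<times> {..<n}. S))"
    by (intro countable_image countable_PiE) (simp_all add: assms)
qed

lemma countable_sub_basis: "countable (sub_basis \<mu>)"
proof -
  have "countable (rational_balls \<mu> i)" for i
  proof (rule countable_subset)
    let ?R = "{C \<in> Mat_level \<mu> i. elements_mat C \<subseteq> \<rat>} \<times> (\<rat> :: real set)"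
    show "rational_balls \<mu> i \<subseteq> (\<lambda>(C, r). mat_ball \<mu> i C r) ` ?R"
      by (auto simp: rational_balls_def)
    show "countable ((\<lambda>(C, r). mat_ball \<mu> i C r) ` ?R)"
      unfolding Mat_level_def
      by (intro countable_image countable_SIGMA countable_carrier_mat countable_rat)
  qed
  then show ?thesis
    unfolding sub_basis_def by (intro countable_UN countable_image) auto
qed

text \<open>Every entry is rounded to a nearby rational, and the Euclidean distance is at most the
  sum of the entrywise errors.\<close>

lemma rational_ball_around:
  assumes A: "A \<in> Mat_level \<mu> i" and r: "r \<in> \<rat>" "0 < r"
  obtains C where "C \<in> Mat_level \<mu> i" "elements_mat C \<subseteq> \<rat>" "mat_dist C A < r"
proof -
  define m n where "m = i * mu_y \<mu>" and "n = i * mu_x \<mu>"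
  \<comment> \<open>There are \<open>m * n\<close> errors below \<open>e\<close> to add up. The
    extra 1 keeps the denominator positive when there are no entries and makes the final bound
    strict.\<close>
  define e where "e = r / (real (m * n) + 1)"
  have e: "e > 0" unfolding e_def using r by (intro divide_pos_pos) linarith+
  have "\<exists>q\<in>\<rat>. \<bar>q - x\<bar> < e" for x :: real
  proof -
    obtain q where "q \<in> \<rat>" "x < q" "q < x + e"
      using Rats_dense_in_real[of x "x + e"] e by auto
    then show ?thesis by (intro bexI[of _ q]) auto
  qed
  then obtain f :: "real \<Rightarrow> real" where f: "\<And>x. f x \<in> \<rat>" "\<And>x. \<bar>f x - x\<bar> < e"
    by metis
  let ?C = "map_mat f A"
  have dim: "dim_row A = m" "dim_col A = n"
    using A by (simp_all add: Mat_level_def m_def n_def)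
  have "mat_dist ?C A
      \<le> (\<Sum>(p, q)\<in>{..<m} \<times> {..<n}. \<bar>?C $$ (p, q) - A $$ (p, q)\<bar>)"
    using L2_set_le_sum_abs[of "\<lambda>(p, q). ?C $$ (p, q) - A $$ (p, q)" "{..<m} \<times> {..<n}"]
    by (simp add: mat_dist_def dim case_prod_unfold)
  also have "\<dots> \<le> (\<Sum>_\<in>{..<m} \<times> {..<n}. e)"
    by (rule sum_mono) (use f(2) dim in \<open>auto intro: less_imp_le\<close>)
  also have "\<dots> = real (m * n) * e"
    by simp
  also have "\<dots> < (real (m * n) + 1) * e"
    using e by (intro mult_strict_right_mono) simp_all
  also have "\<dots> = r"
    using of_nat_0_le_iff[of "m * n", where 'a = real] by (simp add: e_def add_nonneg_eq_0_iff)
  finally have "mat_dist ?C A < r" .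
  moreover have "?C \<in> Mat_level \<mu> i" "elements_mat ?C \<subseteq> \<rat>"
    using A f(1) by (auto simp: Mat_level_def)
  ultimately show thesis using that by blast
qed

lemma entry_le_mat_dist:
  assumes "p < dim_row A" "q < dim_col A"
  shows "\<bar>A $$ (p, q) - B $$ (p, q)\<bar> \<le> mat_dist A B"
proof -
  \<comment> \<open>The absolute value is moved inside the norm so that the bound of a coordinate by
    the norm applies to it; squaring then removes it.\<close>
  have "\<bar>A $$ (p, q) - B $$ (p, q)\<bar>
      \<le> L2_set (\<lambda>x. \<bar>case x of (p, q) \<Rightarrow> A $$ (p, q) - B $$ (p, q)\<bar>)
          ({..<dim_row A} \<times> {..<dim_col A})"
    using member_le_L2_set[of "{..<dim_row A} \<times> {..<dim_col A}" "(p, q)"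
        "\<lambda>x. \<bar>case x of (p, q) \<Rightarrow> A $$ (p, q) - B $$ (p, q)\<bar>"] assms
    by simp
  then show ?thesis by (simp add: mat_dist_def L2_set_def)
qed

text \<open>One entry where \<open>A\<close> and \<open>B\<close> differ already separates them, so
  the triangle inequality is used only for real numbers in that coordinate.\<close>

lemma disjoint_rational_balls:
  assumes A: "A \<in> Mat_level \<mu> i" and B: "B \<in> Mat_level \<mu> i" and "A \<noteq> B"
  obtains U V where "U \<in> rational_balls \<mu> i" "V \<in> rational_balls \<mu> i" "A \<in> U" "B \<in> V"
    "U \<inter> V = {}"
proof -
  obtain p q where pq: "p < i * mu_y \<mu>" "q < i * mu_x \<mu>" and ne: "A $$ (p, q) \<noteq> B $$ (p, q)"
    using assms eq_matI[of B A] by (auto simp: Mat_level_def)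
  \<comment> \<open>In the chosen entry, a point common to both balls is within \<open>2 * r\<close>
    of \<open>A\<close> and of \<open>B\<close>: one radius to the centre and one back. A radius
    below a quarter of the gap excludes this.\<close>
  obtain r where r: "r \<in> \<rat>" "0 < r" "r < \<bar>A $$ (p, q) - B $$ (p, q)\<bar> / 4"
    using Rats_dense_in_real[of 0 "\<bar>A $$ (p, q) - B $$ (p, q)\<bar> / 4"] ne by auto
  obtain C where C: "C \<in> Mat_level \<mu> i" "elements_mat C \<subseteq> \<rat>" "mat_dist C A < r"
    using rational_ball_around[OF A r(1,2)] .
  obtain D where D: "D \<in> Mat_level \<mu> i" "elements_mat D \<subseteq> \<rat>" "mat_dist D B < r"
    using rational_ball_around[OF B r(1,2)] .
  have C_entry: "\<bar>C $$ (p, q) - X $$ (p, q)\<bar> \<le> mat_dist C X" for X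
    using C(1) pq by (intro entry_le_mat_dist) (simp_all add: Mat_level_def)
  have D_entry: "\<bar>D $$ (p, q) - X $$ (p, q)\<bar> \<le> mat_dist D X" for X
    using D(1) pq by (intro entry_le_mat_dist) (simp_all add: Mat_level_def)
  show thesis
  proof (rule that)
    show "mat_ball \<mu> i C r \<in> rational_balls \<mu> i" "mat_ball \<mu> i D r \<in> rational_balls \<mu> i"
      using C D r unfolding rational_balls_def by blast+
    show "A \<in> mat_ball \<mu> i C r" "B \<in> mat_ball \<mu> i D r"
      using A B C D by (simp_all add: mat_ball_def)
    have False if "mat_dist C X < r" "mat_dist D X < r" for X
    proof -
      have "\<bar>A $$ (p, q) - X $$ (p, q)\<bar> < 2 * r"
        using that(1) C_entry[of A] C_entry[of X] C(3) by linarith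
      moreover have "\<bar>B $$ (p, q) - X $$ (p, q)\<bar> < 2 * r"
        using that(2) D_entry[of B] D_entry[of X] D(3) by linarith
      moreover have "4 * r < \<bar>A $$ (p, q) - B $$ (p, q)\<bar>"
        using r(3) by simp
      ultimately show False by linarith
    qed
    then show "mat_ball \<mu> i C r \<inter> mat_ball \<mu> i D r = {}"
      by (auto simp: mat_ball_def)
  qed
qed

lemma mat_equiv_imp_eq:
  assumes "mat_equiv A B" and dim: "dim_row A = dim_row B" "dim_col A = dim_col B"
  shows "A = B"
proof (rule eq_matI)
  fix p q
  assume pq: "p < dim_row B" "q < dim_col B"
  obtain s t where st: "s > 0" "t > 0" and eq: "kronecker A (1\<^sub>m s) = kronecker B (1\<^sub>m t)"
    using assms(1) by (rule mat_equivE)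
  have "dim_row A * s = dim_row B * t"
    using arg_cong[OF eq, of dim_row] by (simp add: kronecker_def)
  \<comment> \<open>The common row count is positive because \<open>p\<close> is a row index, so it
    cancels.\<close>
  then have [simp]: "t = s"
    using dim pq by simp
  \<comment> \<open>The position \<open>(p * s, q * s)\<close> is the top left corner of block
    \<open>(p, q)\<close>, where the identity factor has entry 1.\<close>
  have "kronecker X (1\<^sub>m s) $$ (p * s, q * s) = X $$ (p, q)"
    if "p < dim_row X" "q < dim_col X" for X
    using that st by (simp add: kronecker_def)
  from this[of A] this[of B] show "A $$ (p, q) = B $$ (p, q)"
    using eq dim pq by simp
qed (use dim in simp_all)

lemma class_Mat_level_unique:
  assumes "K \<in> Sigma_quot \<mu>" "A \<in> K" "B \<in> K" "A \<in> Mat_level \<mu> i" "B \<in> Mat_level \<mu> i"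
  shows "A = B"
proof -
  have "(A, B) \<in> mat_equiv_rel \<mu>"
    using quotient_eq_iff[OF equiv_mat_equiv_rel, of K \<mu> K A B] assms
    by (simp add: Sigma_quot_def)
  then show ?thesis
    using assms by (intro mat_equiv_imp_eq) (simp_all add: mat_equiv_rel_def Mat_level_def)
qed

text \<open>Tensoring a representative with \<open>1\<^sub>m s\<close> stays in the class and
  multiplies the level by \<open>s\<close>. Having all multiples available lets two classes be
  compared at a common level.\<close>

lemma class_meets_Mat_level:
  assumes "K \<in> Sigma_quot \<mu>"
  obtains i where "i \<ge> 1" "\<And>s. s \<ge> 1 \<Longrightarrow> K \<inter> Mat_level \<mu> (i * s) \<noteq> {}"
proof -
  obtain A where A: "A \<in> Mat_ratio \<mu>" "K = mat_equiv_rel \<mu> `` {A}"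
    using assms unfolding Sigma_quot_def by (rule quotientE)
  then obtain i where i: "i \<ge> 1" "A \<in> Mat_level \<mu> i"
    by (auto simp: Mat_ratio_def)
  have "K \<inter> Mat_level \<mu> (i * s) \<noteq> {}" if "s \<ge> 1" for s
  proof -
    have *: "kronecker A (1\<^sub>m s) \<in> Mat_level \<mu> (i * s)"
      using i by (simp add: Mat_level_def kronecker_def algebra_simps)
    then have "kronecker A (1\<^sub>m s) \<in> Mat_ratio \<mu>"
      using i that by (auto simp: Mat_ratio_def)
    moreover have "mat_equiv A (kronecker A (1\<^sub>m s))"
      \<comment> \<open>The witnesses say that tensoring the enlarged matrix once more with
        \<open>1\<^sub>m 1\<close> changes nothing.\<close>
      by (rule mat_equivI[of s 1]) (use that kronecker_one_one[of s 1] in simp_all)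
    ultimately show ?thesis
      using A * by (auto simp: mat_equiv_rel_def)
  qed
  with i show thesis using that by blast
qed

lemma openin_Sigma_topology_classes_meeting:
  assumes "i \<ge> 1" "U \<in> rational_balls \<mu> i"
  shows "openin (Sigma_topology \<mu>) (classes_meeting \<mu> U)"
proof -
  have "classes_meeting \<mu> U \<in> sub_basis \<mu>"
    using assms by (auto simp: sub_basis_def)
  then have "(finite intersection_of (\<lambda>U. U \<in> sub_basis \<mu>) relative_to Sigma_quot \<mu>)
      (Sigma_quot \<mu> \<inter> classes_meeting \<mu> U)"
    by (intro relative_to_inc finite_intersection_of_inc)
  \<comment> \<open>Relativizing to the whole space leaves the set unchanged, as it consists of
    classes already.\<close>
  moreover have "Sigma_quot \<mu> \<inter> classes_meeting \<mu> U = classes_meeting \<mu> U"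
    by (auto simp: classes_meeting_def)
  ultimately show ?thesis
    unfolding Sigma_topology_def openin_subbase by (simp add: arbitrary_union_of_inc)
qed

lemma Hausdorff_space_Sigma_topology: "Hausdorff_space (Sigma_topology \<mu>)"
  unfolding Hausdorff_space_def topspace_Sigma_topology
proof (intro allI impI, elim conjE)
  fix K L
  assume K: "K \<in> Sigma_quot \<mu>" and L: "L \<in> Sigma_quot \<mu>" and "K \<noteq> L"
  obtain k where k: "k \<ge> 1" "\<And>s. s \<ge> 1 \<Longrightarrow> K \<inter> Mat_level \<mu> (k * s) \<noteq> {}"
    using class_meets_Mat_level[OF K] by metis
  obtain l where l: "l \<ge> 1" "\<And>s. s \<ge> 1 \<Longrightarrow> L \<inter> Mat_level \<mu> (l * s) \<noteq> {}"
    using class_meets_Mat_level[OF L] by metis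
  \<comment> \<open>The product \<open>k * l\<close> is a multiple of both levels, so both classes
    have a representative there.\<close>
  obtain A where A: "A \<in> K" "A \<in> Mat_level \<mu> (k * l)"
    using k(2)[OF l(1)] by blast
  obtain B where B: "B \<in> L" "B \<in> Mat_level \<mu> (k * l)"
    using l(2)[OF k(1)] by (auto simp: mult.commute)
  have "K \<inter> L = {}"
    using quotient_disj[OF equiv_mat_equiv_rel] K L \<open>K \<noteq> L\<close> unfolding Sigma_quot_def by blast
  then have "A \<noteq> B" using A B by blast
  then obtain U V where UV: "U \<in> rational_balls \<mu> (k * l)" "V \<in> rational_balls \<mu> (k * l)"
    "A \<in> U" "B \<in> V" "U \<inter> V = {}"
    using disjoint_rational_balls A(2) B(2) by metis
  have level: "U \<subseteq> Mat_level \<mu> (k * l)" "V \<subseteq> Mat_level \<mu> (k * l)"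
    using UV(1,2) by (auto simp: rational_balls_def mat_ball_def)
  \<comment> \<open>The members in which a class meets \<open>U\<close> and \<open>V\<close> have
    the same level, hence coincide and would lie in the empty intersection.\<close>
  have "disjnt (classes_meeting \<mu> U) (classes_meeting \<mu> V)"
    unfolding disjnt_iff classes_meeting_def
    using class_Mat_level_unique level UV(5) by blast
  moreover have "openin (Sigma_topology \<mu>) (classes_meeting \<mu> U)"
    "openin (Sigma_topology \<mu>) (classes_meeting \<mu> V)"
    using UV(1,2) k(1) l(1)
    by (simp_all add: openin_Sigma_topology_classes_meeting[of "k * l"])
  moreover have "K \<in> classes_meeting \<mu> U" "L \<in> classes_meeting \<mu> V"
    using K L A B UV(3,4) by (auto simp: classes_meeting_def)
  ultimately show "\<exists>U V. openin (Sigma_topology \<mu>) U \<and> openin (Sigma_topology \<mu>) V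
      \<and> K \<in> U \<and> L \<in> V \<and> disjnt U V"
    by blast
qed

theorem theorem64:
  fixes \<mu> :: rat
  assumes "\<mu> > 0"
  shows "second_countable (Sigma_topology \<mu>) \<and> Hausdorff_space (Sigma_topology \<mu>)"
  unfolding Sigma_topology_def
  using second_countable_subbase[OF countable_sub_basis] Hausdorff_space_Sigma_topology
  by (simp add: Sigma_topology_def)

end
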